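(* Let $G$ be an additive abelian group with no 2-torsion, and let $T(G)$ be the Takasaki quandle of $G$. Then the following hold: (1) $\operatorname{Aut}(T(G)) \cong G \rtimes \operatorname{Aut}(G)$. (2) $\operatorname{Inn}(T(G)) \cong 2G \rtimes \mathbb{Z}/2\mathbb{Z}$.
   Context: A quandle is a set $X$ with a binary operation $*$ such that: (i) $a*a=a$ for all $a\in X$; (ii) for any $a,b\in X$ there is a unique $c\in X$ with $a=c*b$; (iii) $(a*b)*c=(a*c)*(b*c)$ for all $a,b,c\in X$. An automorphism of a quandle $X$ is a bijection $f:X\to X$ with $f(a*b)=f(a)*f(b)$; these form the group $\operatorname{Aut}(X)$ under composition. For $x\in X$, the map $S_x:X\to X$, $S_x(y)=y*x$, is an automorphism of $X$; $\operatorname{Inn}(X)$ denotes the subgroup of $\operatorname{Aut}(X)$ generated by all $S_x$, $x\in X$. For an additive abelian group $G$, the Takasaki quandle $T(G)$ is the set $G$ with operation $a*b=2b-a$. "No 2-torsion" means that $2a=0$ implies $a=0$ for $a\in G$. $2G=\{2a : a\in G\}$. In (1), $\operatorname{Aut}(G)$ is the group of group automorphisms of $G$, acting on $G$ in the natural way, so that $(a_1,f_1)(a_2,f_2)=(a_1+f_1(a_2),f_1f_2)$. In (2), the non-trivial element of $\mathbb{Z}/2\mathbb{Z}$ acts on $2G$ by $a\mapsto -a$. The symbol $\cong$ denotes isomorphism of groups.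
   Formalization: Part (2) is stated only for nontrivial G: for G = 0, which has no 2-torsion, Inn(T(G)) is trivial while 2G ⋊ Z/2Z has order 2, so (2) fails there; part (1) is stated for all G. *)

theory Defs
  imports "HOL-Algebra.Bij" "HOL-Algebra.Elementary_Groups"
begin

record 'a quandle = "'a partial_object" +
  qop :: "'a \<Rightarrow> 'a \<Rightarrow> 'a" (infixl \<open>\<triangleleft>\<index>\<close> 70)

locale quandle =
  fixes Q :: "('a, 'b) quandle_scheme" (structure)
  assumes closed: "\<lbrakk>a \<in> carrier Q; b \<in> carrier Q\<rbrakk> \<Longrightarrow> a \<triangleleft> b \<in> carrier Q"
    and idem: "a \<in> carrier Q \<Longrightarrow> a \<triangleleft> a = a"
    and ex1_right_div: "\<lbrakk>a \<in> carrier Q; b \<in> carrier Q\<rbrakk> \<Longrightarrow> \<exists>!c. c \<in> carrier Q \<and> a = c \<triangleleft> b"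
    and right_distrib: "\<lbrakk>a \<in> carrier Q; b \<in> carrier Q; c \<in> carrier Q\<rbrakk>
      \<Longrightarrow> (a \<triangleleft> b) \<triangleleft> c = (a \<triangleleft> c) \<triangleleft> (b \<triangleleft> c)"

text \<open>As in \<^const>\<open>AutoGroup\<close>, automorphisms are extensional functions on the carrier,
  so that each one has exactly one representative.\<close>

definition quandle_auto :: "('a, 'b) quandle_scheme \<Rightarrow> ('a \<Rightarrow> 'a) set" where
  "quandle_auto Q = {f \<in> Bij (carrier Q).
     \<forall>a \<in> carrier Q. \<forall>b \<in> carrier Q. f (a \<triangleleft>\<^bsub>Q\<^esub> b) = f a \<triangleleft>\<^bsub>Q\<^esub> f b}"

definition QAut :: "('a, 'b) quandle_scheme \<Rightarrow> ('a \<Rightarrow> 'a) monoid" where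
  "QAut Q = BijGroup (carrier Q) \<lparr>carrier := quandle_auto Q\<rparr>"

definition right_transl :: "('a, 'b) quandle_scheme \<Rightarrow> 'a \<Rightarrow> 'a \<Rightarrow> 'a" where
  "right_transl Q x = (\<lambda>y \<in> carrier Q. y \<triangleleft>\<^bsub>Q\<^esub> x)"

text \<open>\<^const>\<open>subgroup_generated\<close> first intersects the generating set with the carrier of the
  ambient group; by \<open>right_transl_in_QAut\<close> below this discards nothing.\<close>

definition QInn :: "('a, 'b) quandle_scheme \<Rightarrow> ('a \<Rightarrow> 'a) monoid" where
  "QInn Q = subgroup_generated (QAut Q) (right_transl Q ` carrier Q)"

text \<open>Abelian groups are written multiplicatively, as in \<^locale>\<open>comm_group\<close>: the additive
  expression \<open>2b - a\<close> becomes \<open>b [^] 2 \<otimes> inv a\<close>.\<close>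

definition Takasaki :: "('a, 'b) monoid_scheme \<Rightarrow> 'a quandle" where
  "Takasaki G = \<lparr>carrier = carrier G, qop = (\<lambda>a b. b [^]\<^bsub>G\<^esub> (2::nat) \<otimes>\<^bsub>G\<^esub> inv\<^bsub>G\<^esub> a)\<rparr>"

definition no_2_torsion :: "('a, 'b) monoid_scheme \<Rightarrow> bool" where
  "no_2_torsion G \<longleftrightarrow> (\<forall>a \<in> carrier G. a [^]\<^bsub>G\<^esub> (2::nat) = \<one>\<^bsub>G\<^esub> \<longrightarrow> a = \<one>\<^bsub>G\<^esub>)"

text \<open>The subgroup written \<open>2G\<close> in additive notation.\<close>

definition doubles :: "('a, 'b) monoid_scheme \<Rightarrow> ('a, 'b) monoid_scheme" where
  "doubles G = G \<lparr>carrier := (\<lambda>a. a [^]\<^bsub>G\<^esub> (2::nat)) ` carrier G\<rparr>"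

text \<open>The external semidirect product of \<open>N\<close> by \<open>H\<close>; meaningful when the action \<open>\<phi>\<close> is a
  homomorphism from \<open>H\<close> to \<^term>\<open>AutoGroup N\<close>.\<close>

definition semidirect_product ::
  "('a, 'c) monoid_scheme \<Rightarrow> ('b, 'd) monoid_scheme \<Rightarrow> ('b \<Rightarrow> 'a \<Rightarrow> 'a) \<Rightarrow> ('a \<times> 'b) monoid" where
  "semidirect_product N H \<phi> =
    \<lparr>carrier = carrier N \<times> carrier H,
     mult = (\<lambda>(a1, h1) (a2, h2). (a1 \<otimes>\<^bsub>N\<^esub> \<phi> h1 a2, h1 \<otimes>\<^bsub>H\<^esub> h2)),
     one = (\<one>\<^bsub>N\<^esub>, \<one>\<^bsub>H\<^esub>)\<rparr>"

definition inversion_action :: "('a, 'b) monoid_scheme \<Rightarrow> int \<Rightarrow> 'a \<Rightarrow> 'a" where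
  "inversion_action N k = (\<lambda>a \<in> carrier N. if k = 0 then a else inv\<^bsub>N\<^esub> a)"


section \<open>Well-definedness\<close>

lemma (in quandle) subgroup_quandle_auto: "subgroup (quandle_auto Q) (BijGroup (carrier Q))"
proof (rule subgroup.intro)
  show "quandle_auto Q \<subseteq> carrier (BijGroup (carrier Q))"
    by (auto simp: quandle_auto_def BijGroup_def)
  show "\<one>\<^bsub>BijGroup (carrier Q)\<^esub> \<in> quandle_auto Q"
    by (simp add: quandle_auto_def BijGroup_def id_Bij closed)
next
  fix f g assume "f \<in> quandle_auto Q" "g \<in> quandle_auto Q"
  then show "f \<otimes>\<^bsub>BijGroup (carrier Q)\<^esub> g \<in> quandle_auto Q"
    using Bij_imp_funcset[of g "carrier Q"]
    by (auto simp: quandle_auto_def BijGroup_def compose_Bij compose_eq closed Pi_iff)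
next
  fix f assume f: "f \<in> quandle_auto Q"
  then have B: "f \<in> Bij (carrier Q)" by (simp add: quandle_auto_def)
  have "inv_into (carrier Q) f (a \<triangleleft> b) = inv_into (carrier Q) f a \<triangleleft> inv_into (carrier Q) f b"
    if "a \<in> carrier Q" "b \<in> carrier Q" for a b
    by (rule Bij_inv_into_lemma[where g = "\<lambda>a b. a \<triangleleft> b"]) (use f B that closed in \<open>auto simp: quandle_auto_def\<close>)
  then show "inv\<^bsub>BijGroup (carrier Q)\<^esub> f \<in> quandle_auto Q"
    using B by (simp add: inv_BijGroup quandle_auto_def restrict_inv_into_Bij closed)
qed

lemma (in quandle) group_QAut: "group (QAut Q)"
  by (simp add: QAut_def subgroup.subgroup_is_group subgroup_quandle_auto group_BijGroup)

lemma (in quandle) right_transl_in_QAut: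
  assumes x: "x \<in> carrier Q"
  shows "right_transl Q x \<in> carrier (QAut Q)"
proof -
  have "inj_on (\<lambda>y. y \<triangleleft> x) (carrier Q)"
  proof (rule inj_onI)
    fix y z assume y: "y \<in> carrier Q" and z: "z \<in> carrier Q" and eq: "y \<triangleleft> x = z \<triangleleft> x"
    from ex1_right_div[OF closed[OF y x] x] obtain d
      where d: "\<And>c. c \<in> carrier Q \<and> y \<triangleleft> x = c \<triangleleft> x \<Longrightarrow> c = d" by (elim ex1E) blast
    have "y = d" using y by (intro d conjI refl)
    moreover have "z = d" using z eq by (intro d conjI)
    ultimately show "y = z" by simp
  qed
  moreover have "(\<lambda>y. y \<triangleleft> x) ` carrier Q = carrier Q"
  proof
    show "(\<lambda>y. y \<triangleleft> x) ` carrier Q \<subseteq> carrier Q"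
      using closed[OF _ x] by (rule image_subsetI)
    show "carrier Q \<subseteq> (\<lambda>y. y \<triangleleft> x) ` carrier Q"
    proof
      fix a assume "a \<in> carrier Q"
      from ex1_right_div[OF this x] obtain c where "c \<in> carrier Q" "a = c \<triangleleft> x" by (elim ex1E conjE)
      then show "a \<in> (\<lambda>y. y \<triangleleft> x) ` carrier Q" by (intro image_eqI)
    qed
  qed
  ultimately have "right_transl Q x \<in> Bij (carrier Q)"
    by (simp add: Bij_def right_transl_def bij_betw_def inj_on_restrict_eq)
  then show ?thesis
    using x right_distrib[OF _ _ x] by (simp add: QAut_def quandle_auto_def right_transl_def closed)
qed

lemma (in comm_group) quandle_Takasaki: "quandle (Takasaki G)"
proof
  fix a b assume ab: "a \<in> carrier (Takasaki G)" "b \<in> carrier (Takasaki G)"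
  then have ab': "a \<in> carrier G" "b \<in> carrier G" by (simp_all add: Takasaki_def)
  show "a \<triangleleft>\<^bsub>Takasaki G\<^esub> b \<in> carrier (Takasaki G)"
    using ab' by (simp add: Takasaki_def)
  show "\<exists>!c. c \<in> carrier (Takasaki G) \<and> a = c \<triangleleft>\<^bsub>Takasaki G\<^esub> b"
  proof (rule ex1I[of _ "b [^] (2::nat) \<otimes> inv a"])
    show "b [^] (2::nat) \<otimes> inv a \<in> carrier (Takasaki G) \<and>
          a = (b [^] (2::nat) \<otimes> inv a) \<triangleleft>\<^bsub>Takasaki G\<^esub> b"
      using ab' by (simp add: Takasaki_def inv_mult_group m_comm[of a] m_assoc[symmetric])
  next
    fix c assume "c \<in> carrier (Takasaki G) \<and> a = c \<triangleleft>\<^bsub>Takasaki G\<^esub> b"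
    then show "c = b [^] (2::nat) \<otimes> inv a"
      using ab' by (simp add: Takasaki_def inv_mult_group m_comm[of c] m_assoc[symmetric])
  qed
next
  fix a assume "a \<in> carrier (Takasaki G)"
  then show "a \<triangleleft>\<^bsub>Takasaki G\<^esub> a = a"
    by (simp add: Takasaki_def numeral_2_eq_2 m_assoc)
next
  fix a b c assume "a \<in> carrier (Takasaki G)" "b \<in> carrier (Takasaki G)" "c \<in> carrier (Takasaki G)"
  then have [simp]: "a \<in> carrier G" "b \<in> carrier G" "c \<in> carrier G" by (simp_all add: Takasaki_def)
  let ?c = "c [^] (2::nat)" and ?b = "b [^] (2::nat)"
  have sq: "(?c \<otimes> inv b) [^] (2::nat) = ?c \<otimes> ?c \<otimes> inv ?b"
    by (simp add: numeral_2_eq_2 inv_mult_group m_ac)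
  have cancel: "(u \<otimes> u \<otimes> v) \<otimes> (inv u \<otimes> w) = u \<otimes> (v \<otimes> w)"
    if "u \<in> carrier G" "v \<in> carrier G" "w \<in> carrier G" for u v w
  proof -
    have "(u \<otimes> u \<otimes> v) \<otimes> (inv u \<otimes> w) = (u \<otimes> u) \<otimes> (inv u \<otimes> (v \<otimes> w))"
      using that by (simp add: m_assoc m_lcomm[of v "inv u" w])
    also have "\<dots> = u \<otimes> ((u \<otimes> inv u) \<otimes> (v \<otimes> w))"
      using that by (simp only: m_assoc m_closed inv_closed)
    finally show ?thesis using that by simp
  qed
  have "c [^] (2::nat) \<otimes> inv (b [^] (2::nat) \<otimes> inv a) = ?c \<otimes> (inv ?b \<otimes> a)"
    by (simp add: inv_mult)
  also have "\<dots> = (?c \<otimes> ?c \<otimes> inv ?b) \<otimes> (inv ?c \<otimes> a)"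
    by (rule cancel[symmetric]) simp_all
  also have "\<dots> = (?c \<otimes> inv b) [^] (2::nat) \<otimes> inv (?c \<otimes> inv a)"
    by (simp add: sq inv_mult)
  finally show "(a \<triangleleft>\<^bsub>Takasaki G\<^esub> b) \<triangleleft>\<^bsub>Takasaki G\<^esub> c =
      (a \<triangleleft>\<^bsub>Takasaki G\<^esub> c) \<triangleleft>\<^bsub>Takasaki G\<^esub> (b \<triangleleft>\<^bsub>Takasaki G\<^esub> c)"
    by (simp add: Takasaki_def)
qed

lemma (in comm_group) comm_group_doubles: "comm_group (doubles G)"
proof -
  have "(\<lambda>a. a [^] (2::nat)) \<in> hom G G"
    by (auto simp: hom_def nat_pow_distrib)
  then have "subgroup ((\<lambda>a. a [^] (2::nat)) ` carrier G) G"
    by (metis group_hom.img_is_subgroup group_hom.intro group_hom_axioms.intro is_group)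
  then show ?thesis
    by (auto simp: doubles_def subgroup.subgroup_is_group is_group m_comm subgroup.mem_carrier
        intro!: group.group_comm_groupI)
qed

lemma (in comm_group) inversion_action_hom:
  "inversion_action G \<in> hom (integer_mod_group 2) (AutoGroup G)"
proof -
  have "bij_betw (\<lambda>a. inv a) (carrier G) (carrier G)"
    by (rule bij_betwI[where g = "\<lambda>a. inv a"]) auto
  then have auto: "inversion_action G k \<in> auto G" for k
    by (auto simp: inversion_action_def auto_def hom_def Bij_def inv_mult bij_betw_def inj_on_restrict_eq)
  show ?thesis
  proof (rule homI)
    fix k l assume "k \<in> carrier (integer_mod_group 2)" "l \<in> carrier (integer_mod_group 2)"
    then have "k \<in> {0, 1}" "l \<in> {0, 1}"
      by (auto simp: carrier_integer_mod_group)
    then have "inversion_action G (k \<otimes>\<^bsub>integer_mod_group 2\<^esub> l) =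
        compose (carrier G) (inversion_action G k) (inversion_action G l)"
      by (auto simp: inversion_action_def compose_def fun_eq_iff restrict_def)
    then show "inversion_action G (k \<otimes>\<^bsub>integer_mod_group 2\<^esub> l) =
        inversion_action G k \<otimes>\<^bsub>AutoGroup G\<^esub> inversion_action G l"
      using auto[of k] auto[of l] by (simp add: AutoGroup_def BijGroup_def auto_def)
  qed (simp add: AutoGroup_def auto)
qed

lemma (in group) natural_action_hom: "(\<lambda>f. f) \<in> hom (AutoGroup G) (AutoGroup G)"
  using group.is_monoid[OF AutoGroup] by (simp add: hom_def monoid.m_closed)

lemma group_semidirect_product:
  assumes N: "group N" and H: "group H" and \<phi>: "\<phi> \<in> hom H (AutoGroup N)"
  shows "group (semidirect_product N H \<phi>)"
proof -
  interpret N: group N by (fact N)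
  interpret H: group H by (fact H)
  have auto: "\<phi> h \<in> auto N" if "h \<in> carrier H" for h
    using hom_in_carrier[OF \<phi> that] by (simp add: AutoGroup_def)
  have hom: "\<phi> h \<in> hom N N" if "h \<in> carrier H" for h
    using auto[OF that] by (simp add: auto_def)
  have closed [simp]: "\<phi> h a \<in> carrier N" if "h \<in> carrier H" "a \<in> carrier N" for h a
    using hom_in_carrier[OF hom] that by blast
  have mult [simp]: "\<phi> h (a \<otimes>\<^bsub>N\<^esub> b) = \<phi> h a \<otimes>\<^bsub>N\<^esub> \<phi> h b"
    if "h \<in> carrier H" "a \<in> carrier N" "b \<in> carrier N" for h a b
    using hom_mult[OF hom] that by blast
  have comp: "\<phi> (g \<otimes>\<^bsub>H\<^esub> h) a = \<phi> g (\<phi> h a)"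
    if "g \<in> carrier H" "h \<in> carrier H" "a \<in> carrier N" for g h a
    using hom_mult[OF \<phi> that(1,2)] auto[OF that(1)] auto[OF that(2)] that(3)
    by (simp add: AutoGroup_def BijGroup_def auto_def compose_eq)
  have one: "\<phi> \<one>\<^bsub>H\<^esub> a = a" if "a \<in> carrier N" for a
    using hom_one[OF \<phi> H N.AutoGroup] that by (simp add: AutoGroup_def BijGroup_def)
  show ?thesis
  proof (rule groupI)
    fix x assume "x \<in> carrier (semidirect_product N H \<phi>)"
    then obtain a h where x: "x = (a, h)" "a \<in> carrier N" "h \<in> carrier H"
      by (auto simp: semidirect_product_def)
    let ?y = "(\<phi> (inv\<^bsub>H\<^esub> h) (inv\<^bsub>N\<^esub> a), inv\<^bsub>H\<^esub> h)"
    have "\<phi> (inv\<^bsub>H\<^esub> h) (inv\<^bsub>N\<^esub> a) \<otimes>\<^bsub>N\<^esub> \<phi> (inv\<^bsub>H\<^esub> h) a = \<one>\<^bsub>N\<^esub>"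
      using x mult[of "inv\<^bsub>H\<^esub> h" "inv\<^bsub>N\<^esub> a" a] hom_one[OF hom N N, of "inv\<^bsub>H\<^esub> h"] by simp
    then have "?y \<in> carrier (semidirect_product N H \<phi>) \<and>
        ?y \<otimes>\<^bsub>semidirect_product N H \<phi>\<^esub> x = \<one>\<^bsub>semidirect_product N H \<phi>\<^esub>"
      using x by (simp add: semidirect_product_def)
    then show "\<exists>y \<in> carrier (semidirect_product N H \<phi>).
        y \<otimes>\<^bsub>semidirect_product N H \<phi>\<^esub> x = \<one>\<^bsub>semidirect_product N H \<phi>\<^esub>"
      by blast
  qed (auto simp: semidirect_product_def comp one N.m_assoc H.m_assoc)
qed

end

theory Submission
  imports Defs
begin

text \<open>The operation of a Takasaki quandle is point reflection, \<open>a * b = 2b - a\<close>, so it is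
  preserved by all maps \<open>x \<mapsto> a + f x\<close> with \<open>f\<close> a group automorphism, and such maps compose by
  the rule of the semidirect product (\<open>affine_map_hom\<close>). Both isomorphisms send a pair \<open>(a, f)\<close>
  to this map.

  For (1) the point is surjectivity. After a translation one may assume that a quandle automorphism
  \<open>f\<close> fixes \<open>0\<close>. Reflecting in \<open>0\<close>, and reflecting \<open>0\<close>, shows that \<open>f\<close> commutes
  with negation and with doubling; hence \<open>2 f(x + y) = f(2x - (-2y)) = 2 (f x + f y)\<close>, and
  the factor 2 may be cancelled in the absence of 2-torsion
  (\<open>point_reflection_preserving_imp_hom\<close>).

  For (2) the generators are the maps \<open>S\<^sub>x\<close>, \<open>y \<mapsto> 2x - y\<close>, that is, the images of
  the pairs \<open>(2x, 1)\<close>; a pair \<open>(2x, 0)\<close> gives \<open>S\<^sub>x S\<^sub>0\<close>. So the image of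
  \<open>2G \<rtimes> \<int>/2\<int>\<close> is the group generated by the reflections. The map is injective unless negation
  is the identity on \<open>G\<close>, which without 2-torsion happens only for the trivial group.\<close>

section \<open>Affine maps as automorphisms of the Takasaki quandle\<close>

definition affine_map :: "('a, 'b) monoid_scheme \<Rightarrow> 'a \<Rightarrow> ('a \<Rightarrow> 'a) \<Rightarrow> 'a \<Rightarrow> 'a" where
  "affine_map G a f = (\<lambda>x \<in> carrier G. a \<otimes>\<^bsub>G\<^esub> f x)"

lemma carrier_Takasaki [simp]: "carrier (Takasaki G) = carrier G"
  by (simp add: Takasaki_def)

lemma qop_Takasaki [simp]: "a \<triangleleft>\<^bsub>Takasaki G\<^esub> b = b [^]\<^bsub>G\<^esub> (2::nat) \<otimes>\<^bsub>G\<^esub> inv\<^bsub>G\<^esub> a"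
  by (simp add: Takasaki_def)

lemma carrier_QAut [simp]: "carrier (QAut Q) = quandle_auto Q"
  by (simp add: QAut_def)

lemma mult_QAut:
  "f \<in> quandle_auto Q \<Longrightarrow> g \<in> quandle_auto Q \<Longrightarrow> f \<otimes>\<^bsub>QAut Q\<^esub> g = compose (carrier Q) f g"
  by (simp add: QAut_def quandle_auto_def BijGroup_def)

lemma carrier_AutoGroup [simp]: "carrier (AutoGroup G) = auto G"
  by (simp add: AutoGroup_def)

lemma mult_AutoGroup:
  "f \<in> auto G \<Longrightarrow> g \<in> auto G \<Longrightarrow> f \<otimes>\<^bsub>AutoGroup G\<^esub> g = compose (carrier G) f g"
  by (simp add: AutoGroup_def auto_def BijGroup_def)

lemma (in group) bij_betw_left_mult:
  assumes "a \<in> carrier G"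
  shows "bij_betw (\<lambda>x. a \<otimes> x) (carrier G) (carrier G)"
  by (rule bij_betwI[where g = "\<lambda>x. inv a \<otimes> x"]) (use assms in \<open>auto simp: m_assoc[symmetric]\<close>)

lemma (in group) affine_map_in_Bij:
  assumes "a \<in> carrier G" "f \<in> Bij (carrier G)"
  shows "affine_map G a f \<in> Bij (carrier G)"
proof -
  have "bij_betw ((\<lambda>x. a \<otimes> x) \<circ> f) (carrier G) (carrier G)"
    using assms bij_betw_left_mult by (auto simp: Bij_def intro: bij_betw_trans)
  then show ?thesis
    by (simp add: Bij_def affine_map_def o_def bij_betw_restrict_eq)
qed

lemma (in comm_group) affine_map_in_quandle_auto:
  assumes a: "a \<in> carrier G" and f: "f \<in> auto G"
  shows "affine_map G a f \<in> quandle_auto (Takasaki G)"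
proof -
  have B: "f \<in> Bij (carrier G)" and h: "f \<in> hom G G"
    using f by (auto simp: auto_def)
  interpret f: group_hom G G f
    by unfold_locales (rule h)
  have "a \<otimes> (u [^] (2::nat) \<otimes> inv v) = (a \<otimes> u) [^] (2::nat) \<otimes> inv (a \<otimes> v)"
    if "u \<in> carrier G" "v \<in> carrier G" for u v
  proof -
    \<comment> \<open>\<open>c\<close> stands for \<open>inv a\<close>; as a variable it is not cancelled before the factors are sorted.\<close>
    have "(a \<otimes> u) [^] (2::nat) \<otimes> (c \<otimes> inv v) = (a \<otimes> (a \<otimes> c)) \<otimes> (u [^] (2::nat) \<otimes> inv v)"
      if "c \<in> carrier G" for c
      using a that \<open>u \<in> carrier G\<close> \<open>v \<in> carrier G\<close> by (simp add: numeral_2_eq_2 m_ac)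
    from this[of "inv a"] show ?thesis using a that by (simp add: inv_mult)
  qed
  then show ?thesis
    using affine_map_in_Bij[OF a B] a
    by (simp add: quandle_auto_def affine_map_def f.hom_nat_pow)
qed

text \<open>The subgroup \<open>N\<close> of translations is a parameter because (1) uses \<open>N = G\<close> and (2) uses
  \<open>N = 2G\<close>. In (2) the action \<open>\<phi>\<close> on \<open>N\<close> is only the restriction of an action \<open>\<rho>\<close> on
  \<open>G\<close>.\<close>

lemma (in comm_group) affine_map_hom:
  assumes N: "N \<subseteq> carrier G"
    and \<rho>: "\<rho> \<in> hom H (AutoGroup G)"
    and \<phi>: "\<And>h a. h \<in> carrier H \<Longrightarrow> a \<in> N \<Longrightarrow> \<phi> h a = \<rho> h a"
  shows "(\<lambda>(a, h). affine_map G a (\<rho> h))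
    \<in> hom (semidirect_product (G\<lparr>carrier := N\<rparr>) H \<phi>) (QAut (Takasaki G))"
proof (rule homI)
  have auto: "\<rho> h \<in> auto G" if "h \<in> carrier H" for h
    using hom_in_carrier[OF \<rho> that] by simp
  fix p q
  assume "p \<in> carrier (semidirect_product (G\<lparr>carrier := N\<rparr>) H \<phi>)"
  then obtain a h where p: "p = (a, h)" "a \<in> N" "h \<in> carrier H"
    by (auto simp: semidirect_product_def)
  show P: "(case p of (a, h) \<Rightarrow> affine_map G a (\<rho> h)) \<in> carrier (QAut (Takasaki G))"
    using p N auto affine_map_in_quandle_auto by auto
  assume "q \<in> carrier (semidirect_product (G\<lparr>carrier := N\<rparr>) H \<phi>)"
  then obtain b k where q: "q = (b, k)" "b \<in> N" "k \<in> carrier H"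
    by (auto simp: semidirect_product_def)
  have Q: "affine_map G b (\<rho> k) \<in> quandle_auto (Takasaki G)"
    using q N auto affine_map_in_quandle_auto by auto
  interpret h: group_hom G G "\<rho> h"
    by unfold_locales (use auto[OF p(3)] in \<open>simp add: auto_def\<close>)
  interpret k: group_hom G G "\<rho> k"
    by unfold_locales (use auto[OF q(3)] in \<open>simp add: auto_def\<close>)
  have ab: "a \<in> carrier G" "b \<in> carrier G" using p q N by auto
  have "affine_map G (a \<otimes> \<rho> h b) (\<rho> (h \<otimes>\<^bsub>H\<^esub> k)) =
      compose (carrier G) (affine_map G a (\<rho> h)) (affine_map G b (\<rho> k))"
    using ab hom_mult[OF \<rho> p(3) q(3)] auto[OF p(3)] auto[OF q(3)]
    by (auto simp: affine_map_def mult_AutoGroup compose_def m_assoc fun_eq_iff)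
  then show "(case p \<otimes>\<^bsub>semidirect_product (G\<lparr>carrier := N\<rparr>) H \<phi>\<^esub> q of (a, h) \<Rightarrow> affine_map G a (\<rho> h)) =
      (case p of (a, h) \<Rightarrow> affine_map G a (\<rho> h)) \<otimes>\<^bsub>QAut (Takasaki G)\<^esub>
      (case q of (a, h) \<Rightarrow> affine_map G a (\<rho> h))"
    using p q P Q \<phi> by (simp add: semidirect_product_def mult_QAut)
qed

text \<open>The translation part is the value at the identity; cancelling it leaves the linear part.\<close>

lemma (in group) affine_map_cancel:
  assumes eq: "affine_map G a f = affine_map G b g"
    and ab: "a \<in> carrier G" "b \<in> carrier G"
    and f: "f \<in> hom G G" and g: "g \<in> hom G G"
    and x: "x \<in> carrier G"
  shows "a = b" and "f x = g x"
proof -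
  have eq': "a \<otimes> f y = b \<otimes> g y" if "y \<in> carrier G" for y
    using fun_cong[OF eq, of y] that by (simp add: affine_map_def)
  have "f \<one> = \<one>" "g \<one> = \<one>"
    using f g by (auto intro: hom_one is_group)
  then show "a = b"
    using eq'[OF one_closed] ab by simp
  then show "f x = g x"
    using eq'[OF x] ab x hom_in_carrier[OF f x] hom_in_carrier[OF g x] by simp
qed

section \<open>Every automorphism of the Takasaki quandle is affine\<close>

lemma (in comm_group) no_2_torsion_square_inj:
  assumes "no_2_torsion G" "a \<in> carrier G" "b \<in> carrier G" "a [^] (2::nat) = b [^] (2::nat)"
  shows "a = b"
proof -
  have "(a \<otimes> inv b) [^] (2::nat) = \<one>"
    using assms by (simp add: nat_pow_distrib nat_pow_inv)
  then have "a \<otimes> inv b = \<one>"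
    using assms by (simp add: no_2_torsion_def)
  then show ?thesis
    using assms by (metis inv_equality inv_inv inv_closed)
qed

lemma (in comm_group) point_reflection_preserving_imp_hom:
  assumes tf: "no_2_torsion G"
    and f: "f \<in> carrier G \<rightarrow> carrier G" and one: "f \<one> = \<one>"
    and refl: "\<And>a b. a \<in> carrier G \<Longrightarrow> b \<in> carrier G \<Longrightarrow>
      f (b [^] (2::nat) \<otimes> inv a) = f b [^] (2::nat) \<otimes> inv (f a)"
  shows "f \<in> hom G G"
proof (rule homI)
  have closed [simp]: "f x \<in> carrier G" if "x \<in> carrier G" for x
    using f that by auto
  have inv: "f (inv x) = inv (f x)" if "x \<in> carrier G" for x
    using refl[of x \<one>] that one by simp
  have square: "f (x [^] (2::nat)) = f x [^] (2::nat)" if "x \<in> carrier G" for x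
    using refl[of \<one> x] that one by simp
  fix x y assume x: "x \<in> carrier G" and y: "y \<in> carrier G"
  have "f (x \<otimes> y) [^] (2::nat) = f (x [^] (2::nat) \<otimes> inv (inv (y [^] (2::nat))))"
    using x y by (simp add: nat_pow_distrib flip: square[OF m_closed])
  also have "\<dots> = f x [^] (2::nat) \<otimes> inv (f (inv (y [^] (2::nat))))"
    using x y by (intro refl) simp_all
  also have "\<dots> = (f x \<otimes> f y) [^] (2::nat)"
    using x y by (simp add: inv square nat_pow_distrib)
  finally show "f (x \<otimes> y) = f x \<otimes> f y"
    by (rule no_2_torsion_square_inj[OF tf, rotated -1]) (simp_all add: x y)
qed (use f in auto)

lemma (in comm_group) quandle_auto_Takasaki_affine:
  assumes tf: "no_2_torsion G" and h: "h \<in> quandle_auto (Takasaki G)"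
  obtains a f where "a \<in> carrier G" "f \<in> auto G" "h = affine_map G a f"
proof
  have B: "h \<in> Bij (carrier G)"
    and refl: "\<And>a b. a \<in> carrier G \<Longrightarrow> b \<in> carrier G \<Longrightarrow>
      h (b [^] (2::nat) \<otimes> inv a) = h b [^] (2::nat) \<otimes> inv (h a)"
    using h by (auto simp: quandle_auto_def)
  have closed [simp]: "h x \<in> carrier G" if "x \<in> carrier G" for x
    using Bij_imp_funcset[OF B] that by auto
  let ?f = "affine_map G (inv (h \<one>)) h"
  have "?f \<in> hom G G"
  proof (rule point_reflection_preserving_imp_hom[OF tf])
    fix a b assume ab: "a \<in> carrier G" "b \<in> carrier G"
    \<comment> \<open>Translations preserve point reflections, so \<open>h\<close> may be corrected by one on the left.\<close>
    have "affine_map G (inv (h \<one>)) (\<lambda>x \<in> carrier G. x) \<in> quandle_auto (Takasaki G)"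
      by (intro affine_map_in_quandle_auto) (simp_all add: auto_def id_Bij hom_def)
    then show "?f (b [^] (2::nat) \<otimes> inv a) = ?f b [^] (2::nat) \<otimes> inv (?f a)"
      using ab by (simp add: quandle_auto_def affine_map_def refl)
  qed (auto simp: affine_map_def)
  then show "?f \<in> auto G"
    using affine_map_in_Bij[OF _ B] by (simp add: auto_def)
  show "h \<one> \<in> carrier G" by simp
  show "h = affine_map G (h \<one>) ?f"
    using Bij_imp_extensional[OF B]
    by (auto simp: affine_map_def fun_eq_iff m_assoc[symmetric] extensional_def)
qed

lemma (in comm_group) QAut_Takasaki_iso:
  assumes tf: "no_2_torsion G"
  shows "QAut (Takasaki G) \<cong> semidirect_product G (AutoGroup G) (\<lambda>f. f)"
proof -
  let ?S = "semidirect_product G (AutoGroup G) (\<lambda>f. f)"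
  let ?\<Phi> = "\<lambda>(a, f). affine_map G a f"
  have carrier: "carrier ?S = carrier G \<times> auto G"
    by (simp add: semidirect_product_def)
  have hom: "?\<Phi> \<in> hom ?S (QAut (Takasaki G))"
    using affine_map_hom[OF subset_refl natural_action_hom, of "\<lambda>f. f"] by simp
  have "inj_on ?\<Phi> (carrier ?S)"
  proof (rule inj_onI, clarsimp simp: carrier)
    fix a f b g
    assume *: "affine_map G a f = affine_map G b g" "a \<in> carrier G" "b \<in> carrier G"
      "f \<in> auto G" "g \<in> auto G"
    then have fg: "f \<in> hom G G" "g \<in> hom G G"
      and ext: "f \<in> extensional (carrier G)" "g \<in> extensional (carrier G)"
      by (auto simp: auto_def Bij_def)
    from affine_map_cancel[OF *(1-3) fg] ext show "a = b \<and> f = g"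
      by (meson extensionalityI one_closed)
  qed
  moreover have "?\<Phi> ` carrier ?S = carrier (QAut (Takasaki G))"
  proof
    show "?\<Phi> ` carrier ?S \<subseteq> carrier (QAut (Takasaki G))"
      by (intro image_subsetI hom_in_carrier[OF hom])
    show "carrier (QAut (Takasaki G)) \<subseteq> ?\<Phi> ` carrier ?S"
    proof
      fix h assume "h \<in> carrier (QAut (Takasaki G))"
      then obtain a f where "a \<in> carrier G" "f \<in> auto G" "h = affine_map G a f"
        using quandle_auto_Takasaki_affine[OF tf] by auto
      then show "h \<in> ?\<Phi> ` carrier ?S"
        by (auto simp: carrier)
    qed
  qed
  ultimately have "?\<Phi> \<in> iso ?S (QAut (Takasaki G))"
    using hom by (simp add: iso_def bij_betw_def)
  then have "?S \<cong> QAut (Takasaki G)"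
    by (auto simp: is_iso_def)
  moreover have "group ?S"
    by (intro group_semidirect_product is_group AutoGroup natural_action_hom)
  ultimately show ?thesis
    by (simp add: group.iso_sym)
qed

section \<open>Inner automorphisms\<close>

lemma (in comm_group) inv_doubles:
  assumes "a \<in> carrier (doubles G)"
  shows "inv\<^bsub>doubles G\<^esub> a = inv a"
proof (rule group.inv_equality)
  interpret D: comm_group "doubles G" by (rule comm_group_doubles)
  show "group (doubles G)" by (rule D.is_group)
  obtain b where b: "b \<in> carrier G" "a = b [^] (2::nat)"
    using assms by (auto simp: doubles_def)
  then show "inv a \<otimes>\<^bsub>doubles G\<^esub> a = \<one>\<^bsub>doubles G\<^esub>"
    by (simp add: doubles_def)
  have "inv a = inv b [^] (2::nat)"
    using b by (simp add: nat_pow_inv)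
  then show "inv a \<in> carrier (doubles G)"
    using b by (auto simp: doubles_def)
qed (rule assms)

lemma (in comm_group) right_transl_Takasaki:
  assumes "x \<in> carrier G"
  shows "right_transl (Takasaki G) x = affine_map G (x [^] (2::nat)) (inversion_action G 1)"
  using assms by (auto simp: right_transl_def affine_map_def inversion_action_def)

lemma (in comm_group) QInn_Takasaki_iso:
  assumes tf: "no_2_torsion G" and nontrivial: "carrier G \<noteq> {\<one>}"
  shows "QInn (Takasaki G) \<cong>
    semidirect_product (doubles G) (integer_mod_group 2) (inversion_action (doubles G))"
proof -
  let ?S = "semidirect_product (doubles G) (integer_mod_group 2) (inversion_action (doubles G))"
  let ?\<Psi> = "\<lambda>(a, k). affine_map G a (inversion_action G k)"
  let ?A = "QAut (Takasaki G)"
  let ?R = "right_transl (Takasaki G) ` carrier (Takasaki G)"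
  interpret T: quandle "Takasaki G" by (rule quandle_Takasaki)
  interpret A: group ?A by (rule T.group_QAut)
  interpret D: comm_group "doubles G" by (rule comm_group_doubles)
  have S: "group ?S"
    by (intro group_semidirect_product D.is_group group_integer_mod_group D.inversion_action_hom)
  have carrier: "carrier ?S = (\<lambda>a. a [^] (2::nat)) ` carrier G \<times> {0, 1}"
    by (auto simp: semidirect_product_def doubles_def carrier_integer_mod_group)
  have act: "inversion_action (doubles G) k a = inversion_action G k a"
    if "a \<in> (\<lambda>a. a [^] (2::nat)) ` carrier G" for k a
    using that inv_doubles[of a] by (auto simp: inversion_action_def doubles_def)
  have hom: "?\<Psi> \<in> hom ?S ?A"
    using affine_map_hom[OF _ inversion_action_hom act,
        where N = "(\<lambda>a. a [^] (2::nat)) ` carrier G"]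
    by (auto simp: doubles_def)
  interpret \<Psi>: group_hom ?S ?A ?\<Psi>
    using S hom by (intro group_hom.intro group_hom_axioms.intro A.is_group)
  have "inj_on ?\<Psi> (carrier ?S)"
  proof (rule inj_onI)
    fix p q assume "p \<in> carrier ?S" "q \<in> carrier ?S" and eq: "?\<Psi> p = ?\<Psi> q"
    then obtain a k b l where p: "p = (a, k)" "a \<in> carrier G" "k \<in> {0, 1}"
      and q: "q = (b, l)" "b \<in> carrier G" "l \<in> {0, 1}"
      by (force simp: carrier)
    have h: "inversion_action G m \<in> hom G G" for m
      by (auto simp: inversion_action_def hom_def inv_mult)
    have eq': "affine_map G a (inversion_action G k) = affine_map G b (inversion_action G l)"
      using eq p q by simp
    obtain x where x: "x \<in> carrier G" "x \<noteq> \<one>"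
      using nontrivial one_closed by blast
    \<comment> \<open>\<open>x\<close> is not its own inverse, so it tells the two linear parts apart.\<close>
    have "x \<noteq> inv x"
    proof
      assume "x = inv x"
      then have "x [^] (2::nat) = \<one>"
        using x r_inv[of x] by (simp add: numeral_2_eq_2)
      then show False
        using tf x by (simp add: no_2_torsion_def)
    qed
    moreover have "inversion_action G k x = inversion_action G l x"
      by (rule affine_map_cancel(2)[OF eq' p(2) q(2) h h x(1)])
    ultimately have "k = l"
      using p(3) q(3) x by (auto simp: inversion_action_def)
    moreover have "a = b"
      by (rule affine_map_cancel(1)[OF eq' p(2) q(2) h h one_closed])
    ultimately show "p = q" using p q by simp
  qed
  moreover have "?\<Psi> ` carrier ?S = generate ?A ?R"
  proof
    show "generate ?A ?R \<subseteq> ?\<Psi> ` carrier ?S"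
    proof (rule A.generate_subgroup_incl)
      show "subgroup (?\<Psi> ` carrier ?S) ?A" by (rule \<Psi>.img_is_subgroup)
      show "?R \<subseteq> ?\<Psi> ` carrier ?S"
        by (auto simp: carrier right_transl_Takasaki intro!: image_eqI[where x = "(_, 1)"])
    qed
    show "?\<Psi> ` carrier ?S \<subseteq> generate ?A ?R"
    proof clarify
      fix a k assume "(a, k) \<in> carrier ?S"
      then obtain x where x: "x \<in> carrier G" "a = x [^] (2::nat)" and k: "k \<in> {0, 1}"
        by (auto simp: carrier)
      have gen: "?\<Psi> (y [^] (2::nat), 1) \<in> generate ?A ?R" if "y \<in> carrier G" for y
        using that right_transl_Takasaki by (auto intro!: generate.incl image_eqI)
      show "affine_map G a (inversion_action G k) \<in> generate ?A ?R"
      proof (cases "k = 1")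
        case True
        then show ?thesis using gen[OF x(1)] x by simp
      next
        case False
        then have k0: "k = 0" using k by simp
        have one: "\<one> \<in> (\<lambda>a. a [^] (2::nat)) ` carrier G"
          by (rule image_eqI[where x = \<one>]) simp_all
        have "(a, 1) \<in> carrier ?S" "(\<one>, 1) \<in> carrier ?S"
          using x one by (simp_all add: carrier)
        then have "?\<Psi> (a, 1) \<otimes>\<^bsub>?A\<^esub> ?\<Psi> (\<one>, 1) = ?\<Psi> ((a, 1) \<otimes>\<^bsub>?S\<^esub> (\<one>, 1))"
          by (simp only: \<Psi>.hom_mult)
        \<comment> \<open>A product of two reflections is a translation: \<open>1 + 1 = 0\<close> in the second factor.\<close>
        also have "(a, 1) \<otimes>\<^bsub>?S\<^esub> (\<one>, 1) = (a, 0)"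
          using x act[OF one] by (simp add: semidirect_product_def doubles_def inversion_action_def)
        finally show ?thesis
          using generate.eng[OF gen[OF x(1)] gen[OF one_closed]] x k0 by simp
      qed
    qed
  qed
  moreover have "?R \<subseteq> carrier ?A"
    using T.right_transl_in_QAut by blast
  ultimately have "?\<Psi> \<in> iso ?S (QInn (Takasaki G))"
    using hom
    by (auto simp: iso_def bij_betw_def hom_def QInn_def subgroup_generated_def Int_absorb1)
  then have "?S \<cong> QInn (Takasaki G)"
    by (auto simp: is_iso_def)
  then show ?thesis
    by (rule group.iso_sym[OF S])
qed

theorem theorem4p2:
  fixes G :: "('a, 'b) monoid_scheme"
  assumes "comm_group G"
    and "no_2_torsion G"
  shows "QAut (Takasaki G) \<cong> semidirect_product G (AutoGroup G) (\<lambda>f. f) \<and>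
    (carrier G \<noteq> {\<one>\<^bsub>G\<^esub>} \<longrightarrow>
      QInn (Takasaki G) \<cong>
        semidirect_product (doubles G) (integer_mod_group 2) (inversion_action (doubles G)))"
  using comm_group.QAut_Takasaki_iso[OF assms] comm_group.QInn_Takasaki_iso[OF assms] by blast

end
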